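(* Let $(X_j,d_j,\tau_j)$, $j\in\mathbb N$, be a sequence of compact timed-metric-spaces such that: (i) (equibounded) there is $D>0$ with $\operatorname{diam}_{d_j}(X_j)\le D$ for all $j$; (ii) (equicompact) for every $R\in(0,D]$ there is $N(R)\in\mathbb N$ such that for every $j$ there are points $x^j_{R,1},\dots,x^j_{R,N(R)}\in X_j$ with $X_j\subset\bigcup_{i=1}^{N(R)}B_{d_j}(x^j_{R,i},R)$; (iii) there is $\tau_{max}>0$ with $\tau_j(X_j)\subset[0,\tau_{max}]$ for all $j$. Then a subsequence (still denoted $(X_j,d_j,\tau_j)$) converges in the intrinsic timed Hausdorff sense to a compact timed-metric-space $(\bar X_\infty,d_\infty,\tau_\infty)$, i.e. $d^\kappa_{\tau-H}\big((X_j,d_j,\tau_j),(\bar X_\infty,d_\infty,\tau_\infty)\big)\to0$. In fact, there exist a compact set $Z\subset\ell^\infty$ and timed-Fréchet maps (which are distance and time preserving) $$\varphi_j:X_j\to[0,\tau_{max}]\times Z\subset\ell^\infty\ (j\in\mathbb N),\qquad \varphi_\infty:\bar X_\infty\to[0,\tau_{max}]\times Z\subset\ell^\infty,$$ such that $$d_H^{[0,\tau_{max}]\times Z}\big(\varphi_j(X_j),\varphi_\infty(\bar X_\infty)\big)\to0 .$$ In addition there exist an uncountable index set $\mathcal A$ (of "addresses") and surjective maps $\mathcal I^j:\mathcal A\to X_j$ ($j\in\mathbb N$) and $\mathcal I^\infty:\mathcal A\to\bar X_\infty$ such that, as $j\to\infty$, $$\sup_{\alpha\in\mathcal A}\big\|\varphi_j(\mathcal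 I^j(\alpha))-\varphi_\infty(\mathcal I^\infty(\alpha))\big\|_{\infty}\to0 .$$ In particular $$\sup_{\alpha\in\mathcal A}\big|\tau_j(\mathcal I^j(\alpha))-\tau_\infty(\mathcal I^\infty(\alpha))\big|\to0 \quad\text{and}\quad \sup_{\alpha,\alpha'\in\mathcal A}\big|d_j(\mathcal I^j(\alpha),\mathcal I^j(\alpha'))-d_\infty(\mathcal I^\infty(\alpha),\mathcal I^\infty(\alpha'))\big|\to0 .$$
   Context: $\ell^\infty$ is the Banach space of bounded real sequences $(s_0,s_1,s_2,\dots)$ with $d_{\ell^\infty}(s,r)=\|s-r\|_\infty=\sup_i|s_i-r_i|$. For subsets $U,W$ of a metric space $(Z',d_{Z'})$, the Hausdorff distance is $d_H^{Z'}(U,W)=\inf\{r>0:\forall u\in U\,\exists w\in W,\ d_{Z'}(u,w)<r,\ \text{and}\ \forall w\in W\,\exists u\in U,\ d_{Z'}(u,w)<r\}$. A timed-metric-space $(X,d,\tau)$ is a metric space $(X,d)$ together with a function $\tau:X\to[0,\infty)$ that is Lipschitz with constant $1$. Given a compact timed-metric-space $(X,d,\tau)$ with $\tau(X)\subset[0,\tau_{max}]$ and a countable dense sequence of points $\mathcal N=\{x_1,x_2,x_3,\dots\}\subset X$, the timed-Fréchet map is $\kappa_{\tau,X,\mathcal N}:X\to[0,\tau_{max}]\times\ell^\infty\subset\ell^\infty$, $\kappa_{\tau,X,\mathcal N}(x)=(\tau(x),d(x_1,x),d(x_2,x),d(x_3,x),\dots)$; here $[0,\tau_{max}]\times Z$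 for $Z\subset\ell^\infty$ denotes the set of sequences $(w_0,z_1,z_2,\dots)$ with $w_0\in[0,\tau_{max}]$ and $(z_1,z_2,\dots)\in Z$. Such maps are distance preserving ($\|\kappa_{\tau,X,\mathcal N}(x)-\kappa_{\tau,X,\mathcal N}(y)\|_\infty=d(x,y)$) and time preserving (the $0$-th coordinate of $\kappa_{\tau,X,\mathcal N}(x)$ is $\tau(x)$). The intrinsic timed Hausdorff distance between compact timed-metric-spaces is $d^\kappa_{\tau-H}\big((X_1,d_1,\tau_1),(X_2,d_2,\tau_2)\big)=\inf d_H^{\ell^\infty}\big(\kappa_{\tau_1,X_1,\mathcal N_1}(X_1),\kappa_{\tau_2,X_2,\mathcal N_2}(X_2)\big)$, the infimum over all countable dense sequences $\mathcal N_i$ in $X_i$ (all choices and orderings); convergence in the intrinsic timed Hausdorff sense means this distance tends to $0$. *)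

theory Defs
  imports "HOL-Analysis.Analysis"
begin

definition metric_on :: "'a set \<Rightarrow> ('a \<Rightarrow> 'a \<Rightarrow> real) \<Rightarrow> bool" where
  "metric_on X d \<longleftrightarrow>
     (\<forall>x\<in>X. \<forall>y\<in>X. 0 \<le> d x y \<and> d x y = d y x \<and> (d x y = 0 \<longleftrightarrow> x = y)) \<and>
     (\<forall>x\<in>X. \<forall>y\<in>X. \<forall>z\<in>X. d x z \<le> d x y + d y z)"

definition compact_in :: "'a set \<Rightarrow> ('a \<Rightarrow> 'a \<Rightarrow> real) \<Rightarrow> 'a set \<Rightarrow> bool" where
  "compact_in X d K \<longleftrightarrow> K \<subseteq> X \<and>
     (\<forall>\<sigma>::nat \<Rightarrow> 'a. range \<sigma> \<subseteq> K \<longrightarrow>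
        (\<exists>l\<in>K. \<exists>r. strict_mono r \<and> (\<lambda>n. d (\<sigma> (r n)) l) \<longlonglongrightarrow> 0))"

definition compact_timed_metric_space ::
  "'a set \<Rightarrow> ('a \<Rightarrow> 'a \<Rightarrow> real) \<Rightarrow> ('a \<Rightarrow> real) \<Rightarrow> bool" where
  "compact_timed_metric_space X d \<tau> \<longleftrightarrow>
     metric_on X d \<and> compact_in X d X \<and>
     (\<forall>x\<in>X. 0 \<le> \<tau> x) \<and>
     (\<forall>x\<in>X. \<forall>y\<in>X. \<bar>\<tau> x - \<tau> y\<bar> \<le> d x y)"

definition linf :: "(nat \<Rightarrow> real) set" where
  "linf = {s. bounded (range s)}"

definition linf_dist :: "(nat \<Rightarrow> real) \<Rightarrow> (nat \<Rightarrow> real) \<Rightarrow> real" where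
  "linf_dist s r = (SUP i. \<bar>s i - r i\<bar>)"

definition hausdorff_linf :: "(nat \<Rightarrow> real) set \<Rightarrow> (nat \<Rightarrow> real) set \<Rightarrow> real" where
  "hausdorff_linf U W = Inf {r. r > 0 \<and>
      (\<forall>u\<in>U. \<exists>w\<in>W. linf_dist u w < r) \<and> (\<forall>w\<in>W. \<exists>u\<in>U. linf_dist u w < r)}"

definition time_prod :: "real \<Rightarrow> (nat \<Rightarrow> real) set \<Rightarrow> (nat \<Rightarrow> real) set" where
  "time_prod tmax Z = {w. w 0 \<in> {0..tmax} \<and> (\<lambda>i. w (Suc i)) \<in> Z}"

text \<open>A countable dense sequence x_1, x_2, ... in X, written N 0, N 1, ...\<close>
definition dense_seq :: "'a set \<Rightarrow> ('a \<Rightarrow> 'a \<Rightarrow> real) \<Rightarrow> (nat \<Rightarrow> 'a) \<Rightarrow> bool" where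
  "dense_seq X d N \<longleftrightarrow> range N \<subseteq> X \<and> (\<forall>x\<in>X. \<forall>e>0. \<exists>i. d (N i) x < e)"

definition timed_frechet ::
  "('a \<Rightarrow> 'a \<Rightarrow> real) \<Rightarrow> ('a \<Rightarrow> real) \<Rightarrow> (nat \<Rightarrow> 'a) \<Rightarrow> 'a \<Rightarrow> (nat \<Rightarrow> real)" where
  "timed_frechet d \<tau> N x = (\<lambda>i. if i = 0 then \<tau> x else d (N (i - 1)) x)"

definition is_timed_frechet_map ::
  "'a set \<Rightarrow> ('a \<Rightarrow> 'a \<Rightarrow> real) \<Rightarrow> ('a \<Rightarrow> real) \<Rightarrow> ('a \<Rightarrow> (nat \<Rightarrow> real)) \<Rightarrow> bool" where
  "is_timed_frechet_map X d \<tau> \<phi> \<longleftrightarrow>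
     (\<exists>N. dense_seq X d N \<and> (\<forall>x\<in>X. \<phi> x = timed_frechet d \<tau> N x))"

definition intrinsic_timed_hausdorff ::
  "'a set \<Rightarrow> ('a \<Rightarrow> 'a \<Rightarrow> real) \<Rightarrow> ('a \<Rightarrow> real) \<Rightarrow>
   'b set \<Rightarrow> ('b \<Rightarrow> 'b \<Rightarrow> real) \<Rightarrow> ('b \<Rightarrow> real) \<Rightarrow> real" where
  "intrinsic_timed_hausdorff X1 d1 \<tau>1 X2 d2 \<tau>2 =
     Inf {hausdorff_linf (timed_frechet d1 \<tau>1 N1 ` X1) (timed_frechet d2 \<tau>2 N2 ` X2) | N1 N2.
            dense_seq X1 d1 N1 \<and> dense_seq X2 d2 N2}"

end

theory Submission
  imports Defs
begin

text \<open>
  By equicompactness all \<open>X j\<close> have \<open>D / 2 ^ k\<close>-nets of a size \<open>M k\<close> independent of \<open>j\<close>. An address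
  is a sequence \<open>\<alpha>\<close> with \<open>\<alpha> k < M k\<close>; following its letters through the nets of \<open>X j\<close> gives a
  surjection \<open>I j\<close> from addresses to \<open>X j\<close> such that addresses with a common prefix of length \<open>k\<close> have
  images at distance at most \<open>8 * D / 2 ^ k\<close>, uniformly in \<open>j\<close>. The distances and times pulled back
  along \<open>I j\<close> are therefore equicontinuous functions of addresses, so an Ascoli argument makes them
  converge uniformly along a subsequence, to a pseudometric \<open>\<rho>\<close> and a time \<open>t\<close>. Enumerating the
  dense sequence in every space by the same dense sequence \<open>a\<close> of addresses, all the timed Frechet
  maps become functions of addresses with coordinates \<open>\<theta>' j \<alpha>\<close> and \<open>\<rho>' j (a i) \<alpha>\<close>, and these
  converge uniformly to \<open>\<Psi> \<alpha> = (t \<alpha>, \<rho> (a 0) \<alpha>, \<rho> (a 1) \<alpha>, ...)\<close>. The image of \<open>\<Psi>\<close> is the limit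
  space, and its own timed Frechet map along \<open>\<Psi> \<circ> a\<close> is the identity.
\<close>


section \<open>Subsequences from Tychonoff compactness and the Ascoli argument\<close>

text \<open>By Tychonoff the product of the \<open>S i\<close> is compact, and a countable product
  of first-countable spaces is first countable, so it is also sequentially compact. This replaces
  every diagonal argument below, both for real values in an interval and for letters in finite
  sets.\<close>

lemma product_subsequence:
  fixes \<sigma> :: "nat \<Rightarrow> nat \<Rightarrow> 'b::first_countable_topology"
  assumes S: "\<And>i. compact (S i)" and \<sigma>: "\<And>n i. \<sigma> n i \<in> S i"
  obtains r l where "strict_mono (r :: nat \<Rightarrow> nat)" "\<And>i. l i \<in> S i"
    "\<And>i. (\<lambda>n. \<sigma> (r n) i) \<longlonglongrightarrow> l i"
proof -
  have "compactin (product_topology (\<lambda>i. euclidean) UNIV) (PiE UNIV S)"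
    using S by (simp add: compactin_PiE)
  then have "compact (PiE UNIV S)"
    by (simp add: euclidean_product_topology)
  then have "seq_compact (PiE UNIV S)"
    by (rule compact_imp_seq_compact)
  moreover have "\<forall>n. \<sigma> n \<in> PiE UNIV S"
    using \<sigma> by auto
  ultimately obtain l r where l: "l \<in> PiE UNIV S" and r: "strict_mono r"
    and lim: "(\<sigma> \<circ> r) \<longlonglongrightarrow> l"
    unfolding seq_compact_def by metis
  have "(\<lambda>n. (\<sigma> \<circ> r) n i) \<longlonglongrightarrow> l i" for i
    using continuous_on_tendsto_compose[OF continuous_on_product_coordinates lim] by simp
  then show thesis
    using that[OF r, of l] l by auto
qed

text \<open>The union of finite nets of mesh \<open>1 / Suc n\<close> is countable, and each of
  these nets is exhausted by an initial segment of an enumeration. The relation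
  \<open>P e s t\<close> stands for "\<open>s\<close> is \<open>e\<close>-close to
  \<open>t\<close>"; it is abstract so that it can mean closeness uniformly over a whole family of
  functions or spaces.\<close>

lemma net_sequence:
  assumes "S \<noteq> {}"
    and nets: "\<And>e::real. 0 < e \<Longrightarrow> \<exists>F. finite F \<and> F \<subseteq> S \<and> (\<forall>s\<in>S. \<exists>t\<in>F. P e s t)"
    and mono: "\<And>e e' s t. e \<le> e' \<Longrightarrow> P e s t \<Longrightarrow> P e' s t"
  obtains a :: "nat \<Rightarrow> 'b" where "\<And>i. a i \<in> S"
    "\<And>e. 0 < e \<Longrightarrow> \<exists>m. \<forall>s\<in>S. \<exists>i<m. P e s (a i)"
proof -
  have "\<exists>F. finite F \<and> F \<subseteq> S \<and> (\<forall>s\<in>S. \<exists>t\<in>F. P (1 / real (Suc n)) s t)" for n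
    by (rule nets) simp
  then obtain F where F: "\<And>n. finite (F n)" "\<And>n. F n \<subseteq> S"
    "\<And>n s. s \<in> S \<Longrightarrow> \<exists>t\<in>F n. P (1 / real (Suc n)) s t"
    by metis
  define a where "a = from_nat_into (\<Union>n. F n)"
  have cF: "countable (\<Union>n. F n)"
    using F(1) by (auto intro: countable_finite)
  have neF: "(\<Union>n. F n) \<noteq> {}"
    using F(3) \<open>S \<noteq> {}\<close> by blast
  have "a i \<in> S" for i
    using from_nat_into[OF neF, of i] F(2) unfolding a_def by blast
  moreover have "\<exists>m. \<forall>s\<in>S. \<exists>i<m. P e s (a i)" if "0 < e" for e
  proof -
    obtain n where n: "1 / real (Suc n) \<le> e"
      using nat_approx_posE[OF \<open>0 < e\<close>] by (metis less_imp_le)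
    have "F n \<subseteq> range a"
      using range_from_nat_into[OF neF cF] unfolding a_def by (metis UN_upper UNIV_I)
    then obtain T where T: "finite T" "F n = a ` T"
      using finite_subset_image[OF F(1)[of n]] by metis
    obtain m where "\<forall>i\<in>T. i < m"
      using T(1) finite_nat_set_iff_bounded by blast
    moreover have "\<exists>i\<in>T. P (1 / real (Suc n)) s (a i)" if "s \<in> S" for s
      using F(3)[OF that, of n] unfolding T(2) by simp
    ultimately have "\<exists>i<m. P e s (a i)" if "s \<in> S" for s
      using that mono[OF n] by metis
    then show ?thesis by blast
  qed
  ultimately show thesis by (rule that)
qed

text \<open>The hypothesis \<open>nets\<close> merges equicontinuity with total boundedness of
  \<open>S\<close>. Convergence at all points of a net sequence is arranged first; finitely many of
  these points then control every \<open>s\<close>, which makes the subsequence uniformly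
  Cauchy.\<close>

lemma ascoli_subsequence:
  fixes f :: "nat \<Rightarrow> 'b \<Rightarrow> real"
  assumes "S \<noteq> {}"
    and bound: "\<And>n s. s \<in> S \<Longrightarrow> \<bar>f n s\<bar> \<le> B"
    and nets: "\<And>e::real. 0 < e \<Longrightarrow>
      \<exists>F. finite F \<and> F \<subseteq> S \<and> (\<forall>s\<in>S. \<exists>t\<in>F. \<forall>n. \<bar>f n s - f n t\<bar> \<le> e)"
  obtains r g where "strict_mono (r :: nat \<Rightarrow> nat)"
    "uniform_limit S (\<lambda>n. f (r n)) g sequentially"
proof -
  obtain a where a: "\<And>i. a i \<in> S"
    and net: "\<And>e::real. 0 < e \<Longrightarrow> \<exists>m. \<forall>s\<in>S. \<exists>i<m::nat. \<forall>n. \<bar>f n s - f n (a i)\<bar> \<le> e"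
  proof (rule net_sequence[of S "\<lambda>e s t. \<forall>n. \<bar>f n s - f n t\<bar> \<le> e"])
    show "\<forall>n. \<bar>f n s - f n t\<bar> \<le> e'" if "e \<le> e'" "\<forall>n. \<bar>f n s - f n t\<bar> \<le> e" for e e' s t
      using that by (meson order_trans)
  qed (use \<open>S \<noteq> {}\<close> nets in auto)
  have "compact {-B..B}" "\<And>n i. f n (a i) \<in> {-B..B}"
    using bound[OF a] by (auto simp: abs_le_iff minus_le_iff)
  then obtain r l where r: "strict_mono (r :: nat \<Rightarrow> nat)"
    and l: "\<And>i. (\<lambda>n. f (r n) (a i)) \<longlonglongrightarrow> l i"
    using product_subsequence[of "\<lambda>_. {-B..B}" "\<lambda>n i. f n (a i)"] by metis
  have "\<exists>M. \<forall>s\<in>S. \<forall>m\<ge>M. \<forall>n\<ge>M. dist (f (r m) s) (f (r n) s) < e" if "0 < e" for e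
  proof -
    obtain m where m: "\<And>s. s \<in> S \<Longrightarrow> \<exists>i<m. \<forall>n. \<bar>f n s - f n (a i)\<bar> \<le> e/4"
      using net[of "e/4"] \<open>0 < e\<close> by auto
    have "\<exists>M. \<forall>p\<ge>M. \<forall>q\<ge>M. dist (f (r p) (a i)) (f (r q) (a i)) < e/4" for i
      using l[of i, THEN LIMSEQ_imp_Cauchy] \<open>0 < e\<close> unfolding Cauchy_def
      by (metis zero_less_divide_iff zero_less_numeral)
    then obtain M where M: "\<And>i p q. p \<ge> M i \<Longrightarrow> q \<ge> M i \<Longrightarrow> dist (f (r p) (a i)) (f (r q) (a i)) < e/4"
      by metis
    \<comment> \<open>Beyond this maximum the values at all \<open>a i\<close> with
      \<open>i < m\<close> have settled up to \<open>e/4\<close>. Passing from \<open>s\<close> to a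
      nearby \<open>a i\<close> and back costs \<open>e/4\<close> each time, so the total stays
      below \<open>e\<close>.\<close>
    have "dist (f (r p) s) (f (r q) s) < e"
      if "s \<in> S" "p \<ge> Max (M ` {..<m})" "q \<ge> Max (M ` {..<m})" for s p q
    proof -
      obtain i where i: "i < m" "\<And>n. \<bar>f n s - f n (a i)\<bar> \<le> e/4"
        using m[OF \<open>s \<in> S\<close>] by blast
      have "M i \<le> Max (M ` {..<m})"
        using i(1) by (intro Max_ge) auto
      then have "\<bar>f (r p) (a i) - f (r q) (a i)\<bar> < e/4"
        using M[of i p q] that by (simp add: dist_real_def)
      then show ?thesis
        using i(2)[of "r p"] i(2)[of "r q"] \<open>0 < e\<close> unfolding dist_real_def by linarith
    qed
    then show ?thesis by blast
  qed
  then have "uniformly_Cauchy_on S (\<lambda>n. f (r n))"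
    by (simp add: uniformly_Cauchy_on_def)
  then obtain g where "uniform_limit S (\<lambda>n. f (r n)) g sequentially"
    using Cauchy_uniformly_convergent unfolding uniformly_convergent_on_def by blast
  with r show thesis by (rule that)
qed

section \<open>The sup distance and the Hausdorff distance on bounded sequences\<close>

lemma linf_dist_le: "(\<And>i. \<bar>u i - v i\<bar> \<le> e) \<Longrightarrow> linf_dist u v \<le> e"
  unfolding linf_dist_def by (rule cSUP_least) auto

text \<open>Boundedness of both sequences makes the set of differences bounded above, which is what
  gives the real supremum its meaning.\<close>

lemma linf_dist_ge:
  assumes "u \<in> linf" "v \<in> linf"
  shows "\<bar>u i - v i\<bar> \<le> linf_dist u v"
proof -
  obtain B C where "\<And>i. \<bar>u i\<bar> \<le> B" "\<And>i. \<bar>v i\<bar> \<le> C"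
    using assms by (auto simp: linf_def bounded_iff)
  then have "\<bar>u i - v i\<bar> \<le> B + C" for i
    by (meson abs_triangle_ineq4 add_mono order_trans)
  then have "bdd_above (range (\<lambda>i. \<bar>u i - v i\<bar>))"
    by (auto simp: bdd_above_def)
  then show ?thesis
    unfolding linf_dist_def by (auto intro: cSUP_upper)
qed

lemma linfI: "(\<And>i. \<bar>u i\<bar> \<le> B) \<Longrightarrow> u \<in> linf"
  by (auto simp: linf_def bounded_iff)

lemma metric_on_linf: "metric_on linf linf_dist"
proof -
  have "linf_dist u w \<le> linf_dist u v + linf_dist v w" if "u \<in> linf" "v \<in> linf" "w \<in> linf" for u v w
  proof (rule linf_dist_le)
    show "\<bar>u i - w i\<bar> \<le> linf_dist u v + linf_dist v w" for i
      using linf_dist_ge[OF that(1,2), of i] linf_dist_ge[OF that(2,3), of i] by linarith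
  qed
  moreover have "0 \<le> linf_dist u v" if "u \<in> linf" "v \<in> linf" for u v
    using linf_dist_ge[OF that, of 0] by linarith
  moreover have "linf_dist u v = linf_dist v u" for u v
    by (simp add: linf_dist_def abs_minus_commute)
  moreover have "linf_dist u v = 0 \<longleftrightarrow> u = v" if "u \<in> linf" "v \<in> linf" for u v
    using linf_dist_ge[OF that] by (auto simp: linf_dist_def intro!: ext)
  ultimately show ?thesis
    unfolding metric_on_def by blast
qed

text \<open>The infimum of an empty set of reals is unspecified, so some admissible radius must be
  exhibited; \<open>\<bar>B\<bar> + 1\<close> is positive and exceeds all the distances.\<close>

lemma hausdorff_linf_nonneg:
  assumes "U \<noteq> {}" "W \<noteq> {}" "\<And>u w. u \<in> U \<Longrightarrow> w \<in> W \<Longrightarrow> linf_dist u w \<le> B"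
  shows "0 \<le> hausdorff_linf U W"
  unfolding hausdorff_linf_def
proof (rule cInf_greatest)
  have "linf_dist u w < \<bar>B\<bar> + 1" if "u \<in> U" "w \<in> W" for u w
    using assms(3)[OF that] by linarith
  then have "\<bar>B\<bar> + 1 \<in> {r. r > 0 \<and>
      (\<forall>u\<in>U. \<exists>w\<in>W. linf_dist u w < r) \<and> (\<forall>w\<in>W. \<exists>u\<in>U. linf_dist u w < r)}"
    using assms(1,2) by fastforce
  then show "{r. r > 0 \<and>
      (\<forall>u\<in>U. \<exists>w\<in>W. linf_dist u w < r) \<and> (\<forall>w\<in>W. \<exists>u\<in>U. linf_dist u w < r)} \<noteq> {}"
    by blast
qed auto

lemma hausdorff_linf_le:
  assumes "\<And>u. u \<in> U \<Longrightarrow> \<exists>w\<in>W. linf_dist u w < e" "\<And>w. w \<in> W \<Longrightarrow> \<exists>u\<in>U. linf_dist u w < e" "0 < e"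
  shows "hausdorff_linf U W \<le> e"
  unfolding hausdorff_linf_def
  by (rule cInf_lower) (use assms in \<open>auto intro!: bdd_belowI[of _ 0]\<close>)

text \<open>The eventual bound serves twice: it dominates the supremum, and it supplies the
  boundedness above under which the supremum is at least any single value, hence
  nonnegative.\<close>

lemma SUP_tendsto_0:
  fixes f :: "nat \<Rightarrow> 'b \<Rightarrow> real"
  assumes "A \<noteq> {}" "\<And>j x. x \<in> A \<Longrightarrow> 0 \<le> f j x"
    and ev: "\<And>e. 0 < e \<Longrightarrow> \<forall>\<^sub>F j in sequentially. \<forall>x\<in>A. f j x \<le> e"
  shows "(\<lambda>j. SUP x\<in>A. f j x) \<longlonglongrightarrow> 0"
proof (rule tendstoI)
  fix e :: real assume "0 < e"
  then have "\<forall>\<^sub>F j in sequentially. \<forall>x\<in>A. f j x \<le> e/2"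
    by (intro ev) simp
  then show "\<forall>\<^sub>F j in sequentially. dist (SUP x\<in>A. f j x) 0 < e"
  proof eventually_elim
    case (elim j)
    obtain x where "x \<in> A" using \<open>A \<noteq> {}\<close> by blast
    have "(SUP x\<in>A. f j x) \<le> e/2"
      using elim \<open>A \<noteq> {}\<close> by (intro cSUP_least) auto
    moreover have "0 \<le> (SUP x\<in>A. f j x)"
      using elim \<open>x \<in> A\<close> assms(2) by (intro cSUP_upper2[of _ _ x]) (auto intro!: bdd_aboveI2[of _ _ "e/2"])
    ultimately show ?case using \<open>0 < e\<close> by simp
  qed
qed

lemma timed_frechet_simps [simp]:
  "timed_frechet d \<tau> N x 0 = \<tau> x" "timed_frechet d \<tau> N x (Suc i) = d (N i) x"
  by (simp_all add: timed_frechet_def)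

section \<open>Addresses and their maps onto compact spaces\<close>

definition addresses :: "(nat \<Rightarrow> nat) \<Rightarrow> (nat \<Rightarrow> nat) set" where
  "addresses M = {\<alpha>. \<forall>k. \<alpha> k < M k}"

text \<open>Cantor's diagonal argument: two letters per position suffice to differ from the
  \<open>k\<close>-th enumerated address at position \<open>k\<close>.\<close>

lemma uncountable_addresses:
  assumes "\<And>k. 2 \<le> M k"
  shows "uncountable (addresses M)"
proof
  assume c: "countable (addresses M)"
  define f where "f = from_nat_into (addresses M)"
  define \<alpha> where "\<alpha> k = (if f k k = 0 then 1 else 0 :: nat)" for k
  have "\<alpha> \<in> addresses M"
    using assms by (auto simp: addresses_def \<alpha>_def intro: less_le_trans[of _ 2])
  then obtain k where "f k = \<alpha>"
    using from_nat_into_surj[OF c] unfolding f_def by blast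
  then have "f k k = \<alpha> k" by simp
  then show False by (auto simp: \<alpha>_def split: if_splits)
qed

text \<open>The representatives are the addresses that are \<open>0\<close> from position
  \<open>k\<close> on; \<open>0\<close> is a legal letter because every \<open>M k\<close> is
  positive.\<close>

lemma finite_prefix_net:
  assumes "\<And>k. 0 < M k"
  obtains F where "finite F" "F \<subseteq> addresses M"
    "\<And>\<alpha>. \<alpha> \<in> addresses M \<Longrightarrow> \<exists>\<beta>\<in>F. \<forall>i<k. \<alpha> i = \<beta> i"
proof
  \<comment> \<open>One common bound for the first \<open>k\<close> letters, in the form needed to
    count functions that vanish off a finite set. For \<open>k = 0\<close> no index is constrained
    by it.\<close>
  let ?B = "{..<Max (M ` {..<k})}"
  let ?F = "addresses M \<inter> {\<beta>. \<forall>i. (i \<in> {..<k} \<longrightarrow> \<beta> i \<in> ?B) \<and> (i \<notin> {..<k} \<longrightarrow> \<beta> i = 0)}"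
  show "finite ?F"
    by (rule finite_Int) (simp only: finite_set_of_finite_funs finite_lessThan simp_thms)
  show "?F \<subseteq> addresses M" by blast
  fix \<alpha> assume \<alpha>: "\<alpha> \<in> addresses M"
  have "\<alpha> i < Max (M ` {..<k})" if "i < k" for i
    by (rule less_le_trans[of _ "M i"]) (use \<alpha> that in \<open>auto simp: addresses_def\<close>)
  then have "(\<lambda>i. if i < k then \<alpha> i else 0) \<in> ?F"
    using \<alpha> assms by (auto simp: addresses_def)
  then show "\<exists>\<beta>\<in>?F. \<forall>i<k. \<alpha> i = \<beta> i"
    by (rule rev_bexI) auto
qed

text \<open>Addresses form a product of finite discrete sets. Convergence of letters means that they
  are eventually equal, and finitely many positions can be treated together.\<close>

lemma addresses_subsequence:
  assumes "\<And>n. \<sigma> n \<in> addresses M"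
  obtains r \<alpha> where "strict_mono (r :: nat \<Rightarrow> nat)" "\<alpha> \<in> addresses M"
    "\<And>k. \<forall>\<^sub>F n in sequentially. \<forall>i<k. \<sigma> (r n) i = \<alpha> i"
proof -
  have "compact {..<M i}" "\<sigma> n i \<in> {..<M i}" for n i
    using assms by (simp_all add: finite_imp_compact addresses_def)
  from product_subsequence[of "\<lambda>i. {..<M i}" \<sigma>, OF this]
  obtain r \<alpha> where r: "strict_mono (r :: nat \<Rightarrow> nat)" and \<alpha>: "\<And>i. \<alpha> i \<in> {..<M i}"
    and lim: "\<And>i. (\<lambda>n. \<sigma> (r n) i) \<longlonglongrightarrow> \<alpha> i"
    by blast
  have "\<forall>\<^sub>F n in sequentially. \<forall>i\<in>{..<k}. \<sigma> (r n) i = \<alpha> i" for k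
    using lim by (intro eventually_ball_finite) (auto simp: tendsto_discrete)
  with r \<alpha> show thesis
    by (intro that[of r \<alpha>]) (auto simp: addresses_def Ball_def)
qed

text \<open>The points reached along an address move by at most \<open>2 * D / 2 ^ k\<close> at step
  \<open>k\<close>, so they have a limit that lies within \<open>4 * D / 2 ^ k\<close> of the
  \<open>k\<close>-th point. A common prefix gives a common \<open>k\<close>-th point, whence the
  constant \<open>8\<close>. Surjectivity comes from choosing at each level a net point close to the
  target.\<close>

lemma address_map:
  assumes metric: "metric_on X d" and cpt: "compact_in X d X"
    and "x0 \<in> X" and diam: "\<And>x y. x \<in> X \<Longrightarrow> y \<in> X \<Longrightarrow> d x y \<le> D"
    and q: "\<And>k a. q k a \<in> X"
    and net: "\<And>k x. x \<in> X \<Longrightarrow> \<exists>a<M k. d (q k a) x < D / 2 ^ Suc k"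
  obtains I where "I ` addresses M = X"
    "\<And>k \<alpha> \<beta>. (\<forall>i<k. \<alpha> i = \<beta> i) \<Longrightarrow> d (I \<alpha>) (I \<beta>) \<le> 8 * D / 2 ^ k"
proof -
  have tri: "d x z \<le> d x y + d y z" if "x \<in> X" "y \<in> X" "z \<in> X" for x y z
    using metric that unfolding metric_on_def by blast
  have sym: "d x y = d y x" and nonneg: "0 \<le> d x y" if "x \<in> X" "y \<in> X" for x y
    using metric that unfolding metric_on_def by blast+
  have zero: "d x x = 0" if "x \<in> X" for x
    using metric that unfolding metric_on_def by blast
  have "0 \<le> D"
    using diam[of x0 x0] zero[of x0] \<open>x0 \<in> X\<close> by simp
  \<comment> \<open>A letter that would move the point too far is ignored, so every address gives a Cauchy
    sequence; along the address of a given point no letter is ignored.\<close>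
  define y where "y \<alpha> = rec_nat x0 (\<lambda>k p. if d p (q k (\<alpha> k)) \<le> 2 * D / 2 ^ k then q k (\<alpha> k) else p)"
    for \<alpha> :: "nat \<Rightarrow> nat"
  have y0: "y \<alpha> 0 = x0" for \<alpha>
    by (simp add: y_def)
  have ySuc: "y \<alpha> (Suc k) = (if d (y \<alpha> k) (q k (\<alpha> k)) \<le> 2 * D / 2 ^ k then q k (\<alpha> k) else y \<alpha> k)" for \<alpha> k
    by (simp add: y_def)
  have yX: "y \<alpha> k \<in> X" for \<alpha> k
    by (induction k) (simp_all add: y0 ySuc q \<open>x0 \<in> X\<close>)
  have y_cong: "y \<alpha> k = y \<beta> k" if "\<forall>i<k. \<alpha> i = \<beta> i" for \<alpha> \<beta> k
    using that by (induction k) (simp_all add: y0 ySuc)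
  have step: "d (y \<alpha> k) (y \<alpha> (Suc k)) \<le> 2 * D / 2 ^ k" for \<alpha> k
    using \<open>0 \<le> D\<close> by (simp add: ySuc zero yX)
  \<comment> \<open>The right-hand side is exactly the geometric sum of the step bounds from
    \<open>k\<close> to \<open>k + n\<close>.\<close>
  have cauchy: "d (y \<alpha> k) (y \<alpha> (k + n)) \<le> 4 * D / 2 ^ k - 4 * D / 2 ^ (k + n)" for \<alpha> k n
  proof (induction n)
    case 0
    then show ?case by (simp add: zero yX)
  next
    case (Suc n)
    have "4 * D / 2 ^ (k + n) - 2 * D / 2 ^ (k + n) = 4 * D / 2 ^ (k + Suc n)"
      by (simp add: field_simps)
    then show ?case
      using Suc step[of \<alpha> "k + n"] tri[OF yX yX yX, of \<alpha> k \<alpha> "k + Suc n" \<alpha> "k + n"] by simp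
  qed
  have "\<exists>l\<in>X. \<forall>k. d (y \<alpha> k) l \<le> 4 * D / 2 ^ k" for \<alpha>
  proof -
    have "range (y \<alpha>) \<subseteq> X" using yX by auto
    then obtain l r where l: "l \<in> X" and r: "strict_mono (r :: nat \<Rightarrow> nat)"
      and lim: "(\<lambda>n. d (y \<alpha> (r n)) l) \<longlonglongrightarrow> 0"
      using cpt unfolding compact_in_def by blast
    \<comment> \<open>Compactness yields only a subsequential limit; the Cauchy estimate carries the
      rate over to every \<open>k\<close>, using \<open>r n \<ge> n \<ge> k\<close>.\<close>
    have "d (y \<alpha> k) l \<le> 4 * D / 2 ^ k" for k
    proof (rule LIMSEQ_le_const)
      show "(\<lambda>n. 4 * D / 2 ^ k + d (y \<alpha> (r n)) l) \<longlonglongrightarrow> 4 * D / 2 ^ k"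
        using tendsto_add[OF tendsto_const lim] by simp
      have "d (y \<alpha> k) l \<le> 4 * D / 2 ^ k + d (y \<alpha> (r n)) l" if "k \<le> n" for n
      proof -
        have "k + (r n - k) = r n"
          using that seq_suble[OF r, of n] by simp
        moreover have "0 \<le> 4 * D / 2 ^ r n" using \<open>0 \<le> D\<close> by simp
        ultimately have "d (y \<alpha> k) (y \<alpha> (r n)) \<le> 4 * D / 2 ^ k"
          using cauchy[of \<alpha> k "r n - k"] by simp
        then show ?thesis using tri[OF yX yX l, of \<alpha> k \<alpha> "r n"] by simp
      qed
      then show "\<exists>N. \<forall>n\<ge>N. d (y \<alpha> k) l \<le> 4 * D / 2 ^ k + d (y \<alpha> (r n)) l" by blast
    qed
    with l show ?thesis by blast
  qed
  then obtain I where IX: "\<And>\<alpha>. I \<alpha> \<in> X" and I: "\<And>\<alpha> k. d (y \<alpha> k) (I \<alpha>) \<le> 4 * D / 2 ^ k"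
    by metis
  show thesis
  proof (rule that)
    have "x \<in> I ` addresses M" if x: "x \<in> X" for x
    proof -
      obtain \<alpha> where \<alpha>: "\<And>k. \<alpha> k < M k" "\<And>k. d (q k (\<alpha> k)) x < D / 2 ^ Suc k"
        using net[OF x] by metis
      \<comment> \<open>This invariant keeps every letter accepted: the next net point is within
        \<open>D / 2 ^ k + D / 2 ^ Suc k\<close> of the current point, below the threshold
        \<open>2 * D / 2 ^ k\<close>. It starts from the diameter bound.\<close>
      have close: "d (y \<alpha> k) x \<le> D / 2 ^ k" for k
      proof (induction k)
        case 0
        then show ?case by (simp add: y0 diam x \<open>x0 \<in> X\<close>)
      next
        case (Suc k)
        have "d (y \<alpha> k) (q k (\<alpha> k)) \<le> d (y \<alpha> k) x + d (q k (\<alpha> k)) x"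
          using tri[OF yX x q] sym[OF x q] by metis
        also have "\<dots> \<le> D / 2 ^ k + D / 2 ^ Suc k"
          using Suc \<alpha>(2)[of k] by linarith
        also have "\<dots> \<le> 2 * D / 2 ^ k"
          using \<open>0 \<le> D\<close> by (simp add: field_simps)
        finally show ?case
          using \<alpha>(2)[of k] by (simp add: ySuc)
      qed
      have "d (I \<alpha>) x \<le> 5 * D / 2 ^ k" for k
        using tri[OF IX yX x, of \<alpha> \<alpha> k] sym[OF IX yX, of \<alpha> \<alpha> k] I[of \<alpha> k] close[of k]
        by (simp add: add_divide_distrib)
      moreover have "(\<lambda>k. 5 * D / 2 ^ k) \<longlonglongrightarrow> 0"
        using LIMSEQ_divide_realpow_zero[of 2 "5 * D"] by simp
      ultimately have "d (I \<alpha>) x \<le> 0"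
        by (intro LIMSEQ_le_const) auto
      then have "d (I \<alpha>) x = 0"
        using nonneg[OF IX x, of \<alpha>] by simp
      then have "I \<alpha> = x"
        using metric IX x unfolding metric_on_def by blast
      then show ?thesis
        using \<alpha>(1) by (auto simp: addresses_def)
    qed
    then show "I ` addresses M = X" using IX by auto
    show "d (I \<alpha>) (I \<beta>) \<le> 8 * D / 2 ^ k" if "\<forall>i<k. \<alpha> i = \<beta> i" for k \<alpha> \<beta>
      using tri[OF IX yX IX, of \<alpha> \<beta> \<alpha> k] sym[OF IX yX, of \<alpha> \<alpha> k] I[of \<alpha> k] I[of \<beta> k]
        y_cong[OF that] by simp
  qed
qed


section \<open>Timed Frechet maps, the intrinsic distance, and compact sets of sequences\<close>

lemma timed_frechet_linf:
  assumes "\<And>i. 0 \<le> d (N i) x \<and> d (N i) x \<le> B" "0 \<le> \<tau> x" "\<tau> x \<le> B"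
  shows "timed_frechet d \<tau> N x \<in> linf"
proof (rule linfI)
  show "\<bar>timed_frechet d \<tau> N x i\<bar> \<le> B" for i
    using assms by (cases i) auto
qed

text \<open>Every coordinate is \<open>1\<close>-Lipschitz, which bounds the sup distance from
  above; the coordinate of some \<open>a i\<close> near \<open>y\<close> nearly attains
  \<open>\<rho> x y\<close>. The formulation is for pseudometrics, since it is applied to addresses,
  where distinct addresses may be at distance zero.\<close>

lemma timed_frechet_isometry:
  assumes tri: "\<And>x y z. x \<in> A \<Longrightarrow> y \<in> A \<Longrightarrow> z \<in> A \<Longrightarrow> \<rho> x z \<le> \<rho> x y + \<rho> y z"
    and sym: "\<And>x y. x \<in> A \<Longrightarrow> y \<in> A \<Longrightarrow> \<rho> x y = \<rho> y x"
    and lip: "\<And>x y. x \<in> A \<Longrightarrow> y \<in> A \<Longrightarrow> \<bar>t x - t y\<bar> \<le> \<rho> x y"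
    and a: "\<And>i. a i \<in> A" and dense: "\<And>x e. x \<in> A \<Longrightarrow> 0 < e \<Longrightarrow> \<exists>i. \<rho> x (a i) \<le> e"
    and linf: "\<And>x. x \<in> A \<Longrightarrow> timed_frechet \<rho> t a x \<in> linf"
    and xy: "x \<in> A" "y \<in> A"
  shows "linf_dist (timed_frechet \<rho> t a x) (timed_frechet \<rho> t a y) = \<rho> x y"
proof (rule antisym)
  show "linf_dist (timed_frechet \<rho> t a x) (timed_frechet \<rho> t a y) \<le> \<rho> x y"
  proof (rule linf_dist_le)
    fix i
    show "\<bar>timed_frechet \<rho> t a x i - timed_frechet \<rho> t a y i\<bar> \<le> \<rho> x y"
    proof (cases i)
      case 0
      then show ?thesis by (simp add: lip xy)
    next
      case (Suc n)
      have "\<rho> (a n) x \<le> \<rho> (a n) y + \<rho> x y" "\<rho> (a n) y \<le> \<rho> (a n) x + \<rho> x y"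
        using tri[OF a xy(2,1)] tri[OF a xy] sym[OF xy] by simp_all
      then show ?thesis using Suc by (simp add: abs_le_iff)
    qed
  qed
  show "\<rho> x y \<le> linf_dist (timed_frechet \<rho> t a x) (timed_frechet \<rho> t a y)"
  proof (rule field_le_epsilon)
    fix e :: real assume "0 < e"
    then obtain i where i: "\<rho> y (a i) \<le> e / 2"
      using dense[OF xy(2), of "e / 2"] by auto
    have "\<rho> x y \<le> \<rho> (a i) x + \<rho> (a i) y"
      using tri[OF xy(1) a xy(2)] sym[OF xy(1) a] by simp
    moreover have "\<rho> (a i) x - \<rho> (a i) y \<le> linf_dist (timed_frechet \<rho> t a x) (timed_frechet \<rho> t a y)"
      using linf_dist_ge[OF linf[OF xy(1)] linf[OF xy(2)], of "Suc i"] by simp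
    ultimately show "\<rho> x y \<le> linf_dist (timed_frechet \<rho> t a x) (timed_frechet \<rho> t a y) + e"
      using i sym[OF xy(2) a[of i]] by linarith
  qed
qed

lemma timed_frechet_dist_bound:
  assumes "range N1 \<subseteq> X1" "range N2 \<subseteq> X2"
    and "\<And>x y. x \<in> X1 \<Longrightarrow> y \<in> X1 \<Longrightarrow> d1 x y \<in> {0..B}" "\<And>x. x \<in> X1 \<Longrightarrow> \<tau>1 x \<in> {0..B}"
    and "\<And>x y. x \<in> X2 \<Longrightarrow> y \<in> X2 \<Longrightarrow> d2 x y \<in> {0..B}" "\<And>x. x \<in> X2 \<Longrightarrow> \<tau>2 x \<in> {0..B}"
    and "x \<in> X1" "y \<in> X2"
  shows "linf_dist (timed_frechet d1 \<tau>1 N1 x) (timed_frechet d2 \<tau>2 N2 y) \<le> B"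
proof (rule linf_dist_le)
  fix i
  have "timed_frechet d1 \<tau>1 N1 x i \<in> {0..B}"
    using assms(1,3,4,7) by (cases i) (simp_all del: atLeastAtMost_iff add: range_subsetD)
  moreover have "timed_frechet d2 \<tau>2 N2 y i \<in> {0..B}"
    using assms(2,5,6,8) by (cases i) (simp_all del: atLeastAtMost_iff add: range_subsetD)
  ultimately show "\<bar>timed_frechet d1 \<tau>1 N1 x i - timed_frechet d2 \<tau>2 N2 y i\<bar> \<le> B"
    by (auto simp: abs_le_iff)
qed

text \<open>The common bound \<open>B\<close> makes every competing Hausdorff distance nonnegative.
  The infimum is then taken over a nonempty set bounded below by \<open>0\<close>, so each choice of
  dense sequences gives an upper bound for it.\<close>

lemma intrinsic_timed_hausdorff_bounds:
  assumes "X1 \<noteq> {}" "X2 \<noteq> {}"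
    and "\<forall>x\<in>X1. \<forall>y\<in>X1. d1 x y \<in> {0..B}" "\<forall>x\<in>X1. \<tau>1 x \<in> {0..B}"
    and "\<forall>x\<in>X2. \<forall>y\<in>X2. d2 x y \<in> {0..B}" "\<forall>x\<in>X2. \<tau>2 x \<in> {0..B}"
    and N: "dense_seq X1 d1 N1" "dense_seq X2 d2 N2"
  shows "0 \<le> hausdorff_linf (timed_frechet d1 \<tau>1 N1 ` X1) (timed_frechet d2 \<tau>2 N2 ` X2)" (is ?A)
    and "0 \<le> intrinsic_timed_hausdorff X1 d1 \<tau>1 X2 d2 \<tau>2" (is ?B)
    and "intrinsic_timed_hausdorff X1 d1 \<tau>1 X2 d2 \<tau>2
      \<le> hausdorff_linf (timed_frechet d1 \<tau>1 N1 ` X1) (timed_frechet d2 \<tau>2 N2 ` X2)" (is ?C)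
proof -
  have nonneg: "0 \<le> hausdorff_linf (timed_frechet d1 \<tau>1 N1 ` X1) (timed_frechet d2 \<tau>2 N2 ` X2)"
    if "dense_seq X1 d1 N1" "dense_seq X2 d2 N2" for N1 N2
  proof (rule hausdorff_linf_nonneg)
    fix u w assume "u \<in> timed_frechet d1 \<tau>1 N1 ` X1" "w \<in> timed_frechet d2 \<tau>2 N2 ` X2"
    then obtain x y where "x \<in> X1" "y \<in> X2" "u = timed_frechet d1 \<tau>1 N1 x" "w = timed_frechet d2 \<tau>2 N2 y"
      by blast
    moreover have "range N1 \<subseteq> X1" "range N2 \<subseteq> X2"
      using that by (auto simp: dense_seq_def)
    ultimately show "linf_dist u w \<le> B"
      using timed_frechet_dist_bound[of N1 X1 N2 X2 d1 B \<tau>1 d2 \<tau>2 x y] assms(3-6) by simp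
  qed (use assms in auto)
  then show ?A using N .
  show ?B
    unfolding intrinsic_timed_hausdorff_def
    by (rule cInf_greatest) (use N nonneg in blast)+
  show ?C
    unfolding intrinsic_timed_hausdorff_def
    by (rule cInf_lower) (use N nonneg in \<open>auto intro!: bdd_belowI[of _ 0]\<close>)
qed

text \<open>
  The relation \<open>\<delta> i i' e\<close> plays the role of "the indices \<open>i\<close> and \<open>i'\<close> are \<open>e\<close>-close", so \<open>Z\<close> is a set
  of bounded equicontinuous functions on a totally bounded index set.
\<close>

lemma compact_equicontinuous:
  fixes \<delta> :: "nat \<Rightarrow> nat \<Rightarrow> real \<Rightarrow> bool"
  assumes tb: "\<And>e. 0 < e \<Longrightarrow> \<exists>m. \<forall>i. \<exists>i'<m. \<delta> i i' e"
    and Z: "Z = {s. (\<forall>i. s i \<in> {0..D}) \<and> (\<forall>i i' e. \<delta> i i' e \<longrightarrow> \<bar>s i - s i'\<bar> \<le> e)}"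
  shows "Z \<subseteq> linf \<and> compact_in linf linf_dist Z"
proof -
  have sub: "Z \<subseteq> linf"
    by (auto simp: Z intro!: linfI[of _ D])
  have "\<exists>l\<in>Z. \<exists>r. strict_mono r \<and> (\<lambda>n. linf_dist (\<sigma> (r n)) l) \<longlonglongrightarrow> 0"
    if "range \<sigma> \<subseteq> Z" for \<sigma> :: "nat \<Rightarrow> nat \<Rightarrow> real"
  proof -
    have \<sigma>: "\<sigma> n i \<in> {0..D}" "\<delta> i i' e \<Longrightarrow> \<bar>\<sigma> n i - \<sigma> n i'\<bar> \<le> e" for n i i' e
      using that unfolding Z by blast+
    \<comment> \<open>Coordinates play the role of points and the sequences
      \<open>\<sigma> n\<close> that of functions, so the Ascoli lemma applies with
      \<open>UNIV\<close> as its domain.\<close>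
    have "\<exists>F. finite F \<and> F \<subseteq> UNIV \<and> (\<forall>i\<in>UNIV. \<exists>i'\<in>F. \<forall>n. \<bar>\<sigma> n i - \<sigma> n i'\<bar> \<le> e)"
      if e: "0 < e" for e
    proof -
      obtain m where "\<And>i. \<exists>i'<m. \<delta> i i' e"
        using tb[OF e] by blast
      then have "\<forall>i\<in>UNIV. \<exists>i'\<in>{..<m}. \<forall>n. \<bar>\<sigma> n i - \<sigma> n i'\<bar> \<le> e"
        using \<sigma>(2) by (meson lessThan_iff)
      then show ?thesis by blast
    qed
    moreover have "\<bar>\<sigma> n i\<bar> \<le> D" for n i
      using \<sigma>(1)[of n i] by simp
    ultimately obtain r l where r: "strict_mono (r :: nat \<Rightarrow> nat)"
      and ul: "uniform_limit UNIV (\<lambda>n. \<sigma> (r n)) l sequentially"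
      using ascoli_subsequence[of UNIV \<sigma> D] by (metis UNIV_not_empty)
    \<comment> \<open>Both conditions that define \<open>Z\<close> are closed under coordinatewise
      limits.\<close>
    have lim: "(\<lambda>n. \<sigma> (r n) i) \<longlonglongrightarrow> l i" for i
      using tendsto_uniform_limitI[OF ul] by simp
    have "l i \<in> {0..D}" for i
      by (rule closed_sequentially[OF closed_atLeastAtMost _ lim[of i]]) (rule \<sigma>)
    moreover have "\<bar>l i - l i'\<bar> \<le> e" if "\<delta> i i' e" for i i' e
      by (rule LIMSEQ_le_const2[OF tendsto_rabs[OF tendsto_diff[OF lim[of i] lim[of i']]]])
        (use \<sigma>(2)[OF that] in blast)
    ultimately have "l \<in> Z" by (auto simp: Z)
    moreover have "(\<lambda>n. linf_dist (\<sigma> (r n)) l) \<longlonglongrightarrow> 0"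
      unfolding linf_dist_def
    proof (rule SUP_tendsto_0)
      show "\<forall>\<^sub>F n in sequentially. \<forall>i\<in>UNIV. \<bar>\<sigma> (r n) i - l i\<bar> \<le> e" if "0 < e" for e
        using uniform_limitD[OF ul that] by (rule eventually_mono) (auto simp: dist_real_def less_imp_le)
    qed auto
    ultimately show ?thesis using r by blast
  qed
  with sub show ?thesis unfolding compact_in_def by blast
qed

theorem theorem3p1:
  fixes X :: "nat \<Rightarrow> 'a set"
    and d :: "nat \<Rightarrow> 'a \<Rightarrow> 'a \<Rightarrow> real"
    and \<tau> :: "nat \<Rightarrow> 'a \<Rightarrow> real"
    and D \<tau>max :: real
  assumes spaces: "\<And>j. compact_timed_metric_space (X j) (d j) (\<tau> j)"
    and nonempty: "\<And>j. X j \<noteq> {}"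
    and D_pos: "D > 0"
    and equibounded: "\<And>j x y. x \<in> X j \<Longrightarrow> y \<in> X j \<Longrightarrow> d j x y \<le> D"
    and equicompact: "\<And>R. 0 < R \<Longrightarrow> R \<le> D \<Longrightarrow>
          \<exists>NR::nat. \<forall>j. \<exists>p::nat \<Rightarrow> 'a. (\<forall>i\<in>{1..NR}. p i \<in> X j) \<and>
             X j \<subseteq> (\<Union>i\<in>{1..NR}. {y \<in> X j. d j (p i) y < R})"
    and tmax_pos: "\<tau>max > 0"
    and time_bound: "\<And>j x. x \<in> X j \<Longrightarrow> \<tau> j x \<in> {0..\<tau>max}"
  shows "\<exists>(r::nat \<Rightarrow> nat) (Xinf :: (nat \<Rightarrow> real) set) dinf \<tau>inf
            (Z :: (nat \<Rightarrow> real) set) (\<phi> :: nat \<Rightarrow> 'a \<Rightarrow> (nat \<Rightarrow> real)) \<phi>inf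
            (A :: (nat \<Rightarrow> nat) set) (I :: nat \<Rightarrow> (nat \<Rightarrow> nat) \<Rightarrow> 'a) Iinf.
      strict_mono r \<and>
      compact_timed_metric_space Xinf dinf \<tau>inf \<and>
      (\<lambda>j. intrinsic_timed_hausdorff (X (r j)) (d (r j)) (\<tau> (r j)) Xinf dinf \<tau>inf)
         \<longlonglongrightarrow> 0 \<and>
      Z \<subseteq> linf \<and> compact_in linf linf_dist Z \<and>
      (\<forall>j. is_timed_frechet_map (X (r j)) (d (r j)) (\<tau> (r j)) (\<phi> j) \<and>
           \<phi> j ` X (r j) \<subseteq> time_prod \<tau>max Z) \<and>
      is_timed_frechet_map Xinf dinf \<tau>inf \<phi>inf \<and>
      \<phi>inf ` Xinf \<subseteq> time_prod \<tau>max Z \<and>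
      (\<lambda>j. hausdorff_linf (\<phi> j ` X (r j)) (\<phi>inf ` Xinf)) \<longlonglongrightarrow> 0 \<and>
      uncountable A \<and>
      (\<forall>j. I j ` A = X (r j)) \<and> Iinf ` A = Xinf \<and>
      (\<lambda>j. SUP \<alpha>\<in>A. linf_dist (\<phi> j (I j \<alpha>)) (\<phi>inf (Iinf \<alpha>))) \<longlonglongrightarrow> 0 \<and>
      (\<lambda>j. SUP \<alpha>\<in>A. \<bar>\<tau> (r j) (I j \<alpha>) - \<tau>inf (Iinf \<alpha>)\<bar>) \<longlonglongrightarrow> 0 \<and>
      (\<lambda>j. SUP p\<in>A \<times> A. \<bar>d (r j) (I j (fst p)) (I j (snd p)) - dinf (Iinf (fst p)) (Iinf (snd p))\<bar>)
         \<longlonglongrightarrow> 0"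
proof -
  have metric: "metric_on (X j) (d j)" and cpt: "compact_in (X j) (d j) (X j)"
    and lip: "\<And>x y. x \<in> X j \<Longrightarrow> y \<in> X j \<Longrightarrow> \<bar>\<tau> j x - \<tau> j y\<bar> \<le> d j x y" for j
    using spaces[of j] by (auto simp: compact_timed_metric_space_def)
  have nonneg: "0 \<le> d j x y" and sym: "d j x y = d j y x" if "x \<in> X j" "y \<in> X j" for j x y
    using metric[of j] that unfolding metric_on_def by blast+
  have tri: "d j x z \<le> d j x y + d j y z" if "x \<in> X j" "y \<in> X j" "z \<in> X j" for j x y z
    using metric[of j] that unfolding metric_on_def by blast

  \<comment> \<open>Nets of uniform size and address maps for all spaces\<close>
  have "\<exists>M::nat. 2 \<le> M \<and> (\<forall>j. \<exists>q::nat \<Rightarrow> 'a. (\<forall>a. q a \<in> X j) \<and> (\<forall>x\<in>X j. \<exists>a<M. d j (q a) x < D / 2 ^ Suc k))" for k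
  proof -
    have "D / 2 ^ Suc k \<le> D / 1"
      by (rule divide_left_mono) (use D_pos in \<open>auto intro: one_le_power simp del: power_Suc\<close>)
    then have "\<exists>NR::nat. \<forall>j. \<exists>p::nat \<Rightarrow> 'a. (\<forall>i\<in>{1..NR}. p i \<in> X j) \<and>
             X j \<subseteq> (\<Union>i\<in>{1..NR}. {y \<in> X j. d j (p i) y < D / 2 ^ Suc k})"
      using D_pos by (intro equicompact) simp_all
    then obtain NR :: nat where NR: "\<And>j. \<exists>p::nat \<Rightarrow> 'a. (\<forall>i\<in>{1..NR}. p i \<in> X j) \<and>
             X j \<subseteq> (\<Union>i\<in>{1..NR}. {y \<in> X j. d j (p i) y < D / 2 ^ Suc k})"
      by blast
    \<comment> \<open>The given points carry the indices \<open>1\<close> to \<open>NR\<close>, all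
      below \<open>NR + 2\<close>, and this number is at least \<open>2\<close>, as uncountability
      of the addresses demands. Spare letters are sent to \<open>x0\<close>, so \<open>q\<close>
      takes values in \<open>X j\<close> everywhere.\<close>
    have "\<exists>q. (\<forall>a. q a \<in> X j) \<and> (\<forall>x\<in>X j. \<exists>a<NR+2. d j (q a) x < D / 2 ^ Suc k)" for j
    proof -
      obtain p :: "nat \<Rightarrow> 'a" where p: "\<forall>i\<in>{1..NR}. p i \<in> X j"
        "X j \<subseteq> (\<Union>i\<in>{1..NR}. {y \<in> X j. d j (p i) y < D / 2 ^ Suc k})"
        using NR[of j] by blast
      obtain x0 where "x0 \<in> X j" using nonempty[of j] by blast
      define q where "q a = (if a \<in> {1..NR} then p a else x0)" for a
      have "\<forall>a. q a \<in> X j"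
        using p(1) \<open>x0 \<in> X j\<close> by (simp add: q_def)
      moreover have "\<exists>a<NR+2. d j (q a) x < D / 2 ^ Suc k" if x: "x \<in> X j" for x
      proof -
        obtain i where "i \<in> {1..NR}" "d j (p i) x < D / 2 ^ Suc k"
          using p(2) x by blast
        then show ?thesis
          by (intro exI[of _ i]) (auto simp: q_def)
      qed
      ultimately show ?thesis by blast
    qed
    then show ?thesis by (intro exI[of _ "NR + 2"]) (simp del: power_Suc)
  qed
  then obtain M where M: "\<And>k. 2 \<le> M k"
    and "\<And>k j. \<exists>q::nat \<Rightarrow> 'a. (\<forall>a. q a \<in> X j) \<and> (\<forall>x\<in>X j. \<exists>a<M k. d j (q a) x < D / 2 ^ Suc k)"
    by metis
  then obtain q where qX: "\<And>j k a. q j k a \<in> X j"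
    and q: "\<And>j k x. x \<in> X j \<Longrightarrow> \<exists>a<M k. d j (q j k a) x < D / 2 ^ Suc k"
    by metis
  define A where "A = addresses M"
  have "\<exists>I. I ` A = X j \<and> (\<forall>k \<alpha> \<beta>. (\<forall>i<k. \<alpha> i = \<beta> i) \<longrightarrow> d j (I \<alpha>) (I \<beta>) \<le> 8 * D / 2 ^ k)" for j
  proof -
    obtain x0 where "x0 \<in> X j" using nonempty[of j] by blast
    show ?thesis
    proof (rule address_map[OF metric[of j] cpt[of j] \<open>x0 \<in> X j\<close> equibounded[of _ j] qX[of j] q[of _ j]])
      fix I assume "I ` addresses M = X j"
        "\<And>k \<alpha> \<beta>. (\<forall>i<k. \<alpha> i = \<beta> i) \<Longrightarrow> d j (I \<alpha>) (I \<beta>) \<le> 8 * D / 2 ^ k"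
      then show ?thesis unfolding A_def by blast
    qed
  qed
  then obtain I where IA: "\<And>j. I j ` A = X j"
    and I: "\<And>j k \<alpha> \<beta>. (\<forall>i<k. \<alpha> i = \<beta> i) \<Longrightarrow> d j (I j \<alpha>) (I j \<beta>) \<le> 8 * D / 2 ^ k"
    by metis
  have IX: "I j \<alpha> \<in> X j" if "\<alpha> \<in> A" for j \<alpha>
    using IA that by blast
  have uncountable: "uncountable A"
    unfolding A_def by (rule uncountable_addresses) (rule M)
  then have "A \<noteq> {}" by auto

  \<comment> \<open>Equicontinuity of the distances and times pulled back to addresses\<close>
  define \<rho>' where "\<rho>' j \<alpha> \<beta> = d j (I j \<alpha>) (I j \<beta>)" for j \<alpha> \<beta>
  define \<theta>' where "\<theta>' j \<alpha> = \<tau> j (I j \<alpha>)" for j \<alpha>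
  have \<rho>'_bd: "\<rho>' j \<alpha> \<beta> \<in> {0..D}" if "\<alpha> \<in> A" "\<beta> \<in> A" for j \<alpha> \<beta>
    using that by (simp add: \<rho>'_def nonneg equibounded IX)
  have \<theta>'_bd: "\<theta>' j \<alpha> \<in> {0..\<tau>max}" if "\<alpha> \<in> A" for j \<alpha>
    unfolding \<theta>'_def using that by (intro time_bound IX)
  have \<rho>'_sym: "\<rho>' j \<alpha> \<beta> = \<rho>' j \<beta> \<alpha>" if "\<alpha> \<in> A" "\<beta> \<in> A" for j \<alpha> \<beta>
    unfolding \<rho>'_def using that by (intro sym IX)
  have \<rho>'_tri: "\<rho>' j \<alpha> \<gamma> \<le> \<rho>' j \<alpha> \<beta> + \<rho>' j \<beta> \<gamma>" if "\<alpha> \<in> A" "\<beta> \<in> A" "\<gamma> \<in> A" for j \<alpha> \<beta> \<gamma>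
    unfolding \<rho>'_def using that by (intro tri IX)
  have \<rho>'_diff: "\<bar>\<rho>' j \<alpha> \<beta> - \<rho>' j \<alpha>' \<beta>'\<bar> \<le> \<rho>' j \<alpha> \<alpha>' + \<rho>' j \<beta> \<beta>'"
    if "\<alpha> \<in> A" "\<beta> \<in> A" "\<alpha>' \<in> A" "\<beta>' \<in> A" for j \<alpha> \<beta> \<alpha>' \<beta>'
    using \<rho>'_tri[of \<alpha> \<alpha>' \<beta> j] \<rho>'_tri[of \<alpha>' \<beta>' \<beta> j] \<rho>'_tri[of \<alpha>' \<alpha> \<beta>' j] \<rho>'_tri[of \<alpha> \<beta> \<beta>' j]
      \<rho>'_sym[of \<alpha> \<alpha>' j] \<rho>'_sym[of \<beta> \<beta>' j] that by linarith
  have \<theta>'_lip: "\<bar>\<theta>' j \<alpha> - \<theta>' j \<beta>\<bar> \<le> \<rho>' j \<alpha> \<beta>" if "\<alpha> \<in> A" "\<beta> \<in> A" for j \<alpha> \<beta>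
    unfolding \<rho>'_def \<theta>'_def using that by (intro lip IX)

  \<comment> \<open>The prefix length \<open>k\<close> depends on \<open>e\<close> alone; its
    independence of \<open>j\<close> is the equicontinuity on which the compactness arguments
    rest.\<close>
  have modulus: "\<exists>k. \<forall>\<alpha> \<beta>. (\<forall>i<k. \<alpha> i = \<beta> i) \<longrightarrow> (\<forall>j. \<rho>' j \<alpha> \<beta> \<le> e)" if "0 < e" for e
  proof -
    have "(\<lambda>k. 8 * D / 2 ^ k) \<longlonglongrightarrow> 0"
      using LIMSEQ_divide_realpow_zero[of 2 "8 * D"] by simp
    then have "\<forall>\<^sub>F k in sequentially. 8 * D / 2 ^ k < e"
      using \<open>0 < e\<close> by (rule order_tendstoD)
    then obtain k where "8 * D / 2 ^ k < e"
      using eventually_happens'[OF sequentially_bot] by blast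
    then show ?thesis
      using I[of k] unfolding \<rho>'_def by (meson less_imp_le order_trans)
  qed
  have tb: "\<exists>F. finite F \<and> F \<subseteq> A \<and> (\<forall>\<alpha>\<in>A. \<exists>\<beta>\<in>F. \<forall>j. \<rho>' j \<alpha> \<beta> \<le> e)" if e: "0 < e" for e
  proof -
    obtain k where k: "\<And>\<alpha> \<beta>. (\<forall>i<k. \<alpha> i = \<beta> i) \<longrightarrow> (\<forall>j. \<rho>' j \<alpha> \<beta> \<le> e)"
      using modulus[OF e] by blast
    have "0 < M i" for i using M[of i] by linarith
    then obtain F where F: "finite F" "F \<subseteq> A" "\<And>\<alpha>. \<alpha> \<in> A \<Longrightarrow> \<exists>\<beta>\<in>F. \<forall>i<k. \<alpha> i = \<beta> i"
      unfolding A_def by (rule finite_prefix_net[of M k]) auto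
    then show ?thesis using k by metis
  qed

  \<comment> \<open>Extraction of a uniformly convergent subsequence\<close>
  obtain r1 t where r1: "strict_mono (r1 :: nat \<Rightarrow> nat)"
    and ut: "uniform_limit A (\<lambda>n. \<theta>' (r1 n)) t sequentially"
  proof (rule ascoli_subsequence[of A \<theta>' \<tau>max])
    show "\<exists>F. finite F \<and> F \<subseteq> A \<and> (\<forall>\<alpha>\<in>A. \<exists>\<beta>\<in>F. \<forall>n. \<bar>\<theta>' n \<alpha> - \<theta>' n \<beta>\<bar> \<le> e)" if e: "0 < e" for e
    proof -
      obtain F where F: "finite F" "F \<subseteq> A" "\<And>\<alpha>. \<alpha> \<in> A \<Longrightarrow> \<exists>\<beta>\<in>F. \<forall>j. \<rho>' j \<alpha> \<beta> \<le> e"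
        using tb[OF e] by blast
      have "\<exists>\<beta>\<in>F. \<forall>n. \<bar>\<theta>' n \<alpha> - \<theta>' n \<beta>\<bar> \<le> e" if "\<alpha> \<in> A" for \<alpha>
        using F(3)[OF that] \<theta>'_lip[OF that] F(2) by (meson order_trans subsetD)
      then show ?thesis using F by blast
    qed
    show "\<bar>\<theta>' n \<alpha>\<bar> \<le> \<tau>max" if "\<alpha> \<in> A" for n \<alpha>
      using \<theta>'_bd[OF that, of n] by simp
  qed (use \<open>A \<noteq> {}\<close> in auto)
  \<comment> \<open>The distances are refined along \<open>r1\<close>, so the times keep converging.
    Nets in pairs are products of \<open>e / 2\<close>-nets, one half of \<open>e\<close> being
    spent in each argument of the pseudometric.\<close>
  obtain r2 g where r2: "strict_mono (r2 :: nat \<Rightarrow> nat)"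
    and ug: "uniform_limit (A \<times> A) (\<lambda>n p. \<rho>' (r1 (r2 n)) (fst p) (snd p)) g sequentially"
  proof (rule ascoli_subsequence[of "A \<times> A" "\<lambda>n p. \<rho>' (r1 n) (fst p) (snd p)" D])
    show "\<exists>F. finite F \<and> F \<subseteq> A \<times> A \<and> (\<forall>p\<in>A \<times> A. \<exists>p'\<in>F. \<forall>n.
      \<bar>\<rho>' (r1 n) (fst p) (snd p) - \<rho>' (r1 n) (fst p') (snd p')\<bar> \<le> e)" if e: "0 < e" for e
    proof -
      have "0 < e / 2" using e by simp
      then obtain F where F: "finite F" "F \<subseteq> A" "\<And>\<alpha>. \<alpha> \<in> A \<Longrightarrow> \<exists>\<beta>\<in>F. \<forall>j. \<rho>' j \<alpha> \<beta> \<le> e / 2"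
        using tb by meson
      have "\<exists>p'\<in>F \<times> F. \<forall>n. \<bar>\<rho>' (r1 n) (fst p) (snd p) - \<rho>' (r1 n) (fst p') (snd p')\<bar> \<le> e"
        if p: "p \<in> A \<times> A" for p
      proof -
        have pA: "fst p \<in> A" "snd p \<in> A" using p by auto
        obtain \<alpha> where \<alpha>: "\<alpha> \<in> F" "\<And>j. \<rho>' j (fst p) \<alpha> \<le> e / 2"
          using F(3)[OF pA(1)] by blast
        obtain \<beta> where \<beta>: "\<beta> \<in> F" "\<And>j. \<rho>' j (snd p) \<beta> \<le> e / 2"
          using F(3)[OF pA(2)] by blast
        have "\<alpha> \<in> A" "\<beta> \<in> A" using \<alpha>(1) \<beta>(1) F(2) by auto
        then have "\<bar>\<rho>' j (fst p) (snd p) - \<rho>' j \<alpha> \<beta>\<bar> \<le> e" for j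
          using \<rho>'_diff[OF pA, of \<alpha> \<beta> j] \<alpha>(2)[of j] \<beta>(2)[of j] by linarith
        then show ?thesis
          using \<alpha>(1) \<beta>(1) by (intro bexI[of _ "(\<alpha>, \<beta>)"]) auto
      qed
      then show ?thesis
        using F(1,2) by (intro exI[of _ "F \<times> F"]) auto
    qed
    show "\<bar>\<rho>' (r1 n) (fst p) (snd p)\<bar> \<le> D" if "p \<in> A \<times> A" for n p
      using \<rho>'_bd[of "fst p" "snd p" "r1 n"] that by auto
  qed (use \<open>A \<noteq> {}\<close> in auto)
  define r where "r = r1 \<circ> r2"
  define \<rho> where "\<rho> \<alpha> \<beta> = g (\<alpha>, \<beta>)" for \<alpha> \<beta>
  have r: "strict_mono r"
    unfolding r_def using r1 r2 by (rule strict_mono_o)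
  have conv_t: "\<forall>\<^sub>F j in sequentially. \<forall>\<alpha>\<in>A. \<bar>\<theta>' (r j) \<alpha> - t \<alpha>\<bar> \<le> e" if "0 < e" for e
    using eventually_subseq[OF r2 uniform_limitD[OF ut that]]
    by (rule eventually_mono) (auto simp: r_def dist_real_def less_imp_le)
  have conv_\<rho>: "\<forall>\<^sub>F j in sequentially. \<forall>\<alpha>\<in>A. \<forall>\<beta>\<in>A. \<bar>\<rho>' (r j) \<alpha> \<beta> - \<rho> \<alpha> \<beta>\<bar> \<le> e" if "0 < e" for e
    using uniform_limitD[OF ug that]
    by (rule eventually_mono) (auto simp: r_def \<rho>_def dist_real_def less_imp_le)
  have lim_t: "(\<lambda>j. \<theta>' (r j) \<alpha>) \<longlonglongrightarrow> t \<alpha>" if "\<alpha> \<in> A" for \<alpha>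
    using LIMSEQ_subseq_LIMSEQ[OF tendsto_uniform_limitI[OF ut that] r2] by (simp add: r_def o_def)
  have lim_\<rho>: "(\<lambda>j. \<rho>' (r j) \<alpha> \<beta>) \<longlonglongrightarrow> \<rho> \<alpha> \<beta>" if "\<alpha> \<in> A" "\<beta> \<in> A" for \<alpha> \<beta>
    using tendsto_uniform_limitI[OF ug, of "(\<alpha>, \<beta>)"] that by (simp add: r_def \<rho>_def)

  \<comment> \<open>The limit pseudometric and the limit time\<close>
  have \<rho>_bd: "\<rho> \<alpha> \<beta> \<in> {0..D}" if "\<alpha> \<in> A" "\<beta> \<in> A" for \<alpha> \<beta>
    by (rule closed_sequentially[OF closed_atLeastAtMost \<rho>'_bd[OF that] lim_\<rho>[OF that]])
  have t_bd: "t \<alpha> \<in> {0..\<tau>max}" if "\<alpha> \<in> A" for \<alpha>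
    by (rule closed_sequentially[OF closed_atLeastAtMost \<theta>'_bd[OF that] lim_t[OF that]])
  have \<rho>_sym: "\<rho> \<alpha> \<beta> = \<rho> \<beta> \<alpha>" if "\<alpha> \<in> A" "\<beta> \<in> A" for \<alpha> \<beta>
    using LIMSEQ_unique[OF lim_\<rho>[OF that] lim_\<rho>[OF that(2,1), folded \<rho>'_sym[OF that]]] .
  have \<rho>_tri: "\<rho> \<alpha> \<gamma> \<le> \<rho> \<alpha> \<beta> + \<rho> \<beta> \<gamma>" if "\<alpha> \<in> A" "\<beta> \<in> A" "\<gamma> \<in> A" for \<alpha> \<beta> \<gamma>
    by (rule LIMSEQ_le[OF lim_\<rho>[OF that(1,3)] tendsto_add[OF lim_\<rho>[OF that(1,2)] lim_\<rho>[OF that(2,3)]]])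
      (use \<rho>'_tri[OF that] in blast)
  have t_lip: "\<bar>t \<alpha> - t \<beta>\<bar> \<le> \<rho> \<alpha> \<beta>" if "\<alpha> \<in> A" "\<beta> \<in> A" for \<alpha> \<beta>
    by (rule LIMSEQ_le[OF tendsto_rabs[OF tendsto_diff[OF lim_t[OF that(1)] lim_t[OF that(2)]]] lim_\<rho>[OF that]])
      (use \<theta>'_lip[OF that] in blast)
  \<comment> \<open>Closeness uniform in \<open>j\<close> passes to the limit, so nets found for all
    \<open>\<rho>' j\<close> at once are also nets for \<open>\<rho>\<close>.\<close>
  have \<rho>_le: "\<rho> \<alpha> \<beta> \<le> e" if "\<alpha> \<in> A" "\<beta> \<in> A" "\<And>j. \<rho>' j \<alpha> \<beta> \<le> e" for \<alpha> \<beta> e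
    by (rule LIMSEQ_le_const2[OF lim_\<rho>[OF that(1,2)]]) (use that(3) in blast)

  \<comment> \<open>Because closeness is required for all \<open>j\<close> simultaneously, one
    sequence of addresses is dense for every space and for the limit. This aligns the coordinates of
    all the Frechet maps.\<close>
  obtain a where aA: "\<And>i. a i \<in> A"
    and a: "\<And>e. 0 < e \<Longrightarrow> \<exists>m. \<forall>\<alpha>\<in>A. \<exists>i<m::nat. \<forall>j. \<rho>' j \<alpha> (a i) \<le> e"
  proof (rule net_sequence[of A "\<lambda>e \<alpha> \<beta>. \<forall>j. \<rho>' j \<alpha> \<beta> \<le> e"])
    show "\<forall>j. \<rho>' j \<alpha> \<beta> \<le> e'" if "e \<le> e'" "\<forall>j. \<rho>' j \<alpha> \<beta> \<le> e" for e e' \<alpha> \<beta>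
      using that by (meson order_trans)
  qed (use \<open>A \<noteq> {}\<close> tb in auto)
  have a_dense: "\<exists>i. \<rho> \<alpha> (a i) \<le> e" if "\<alpha> \<in> A" "0 < e" for \<alpha> e
    using a[OF that(2)] \<rho>_le[OF that(1) aA] that(1) by meson

  \<comment> \<open>The limit space and the timed Frechet maps\<close>
  define N where "N j i = I j (a i)" for j i
  define \<phi> where "\<phi> j = timed_frechet (d (r j)) (\<tau> (r j)) (N (r j))" for j
  define \<Psi> where "\<Psi> = timed_frechet \<rho> t a"
  \<comment> \<open>Taking the image under \<open>\<Psi>\<close> performs the metric quotient:
    addresses at \<open>\<rho>\<close>-distance zero are identified.\<close>
  define Xinf where "Xinf = \<Psi> ` A"
  define \<tau>inf where "\<tau>inf s = s 0" for s :: "nat \<Rightarrow> real"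
  \<comment> \<open>\<open>Z\<close> collects the possible distance coordinates: a distance to a
    fixed point changes by at most \<open>e\<close> when \<open>a i\<close> is replaced by an
    \<open>a i'\<close> that is \<open>e\<close>-close to it in all spaces. This makes
    \<open>Z\<close> a bounded equicontinuous family.\<close>
  define Z where "Z = {s :: nat \<Rightarrow> real. (\<forall>i. s i \<in> {0..D}) \<and>
    (\<forall>i i' e. (\<forall>j. \<rho>' j (a i) (a i') \<le> e) \<longrightarrow> \<bar>s i - s i'\<bar> \<le> e)}"

  have \<phi>_I: "\<phi> j (I (r j) \<alpha>) 0 = \<theta>' (r j) \<alpha>" "\<phi> j (I (r j) \<alpha>) (Suc i) = \<rho>' (r j) (a i) \<alpha>" for j \<alpha> i
    by (simp_all add: \<phi>_def \<theta>'_def \<rho>'_def N_def)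
  have \<Psi>_simps: "\<Psi> \<alpha> 0 = t \<alpha>" "\<Psi> \<alpha> (Suc i) = \<rho> (a i) \<alpha>" for \<alpha> i
    by (simp_all add: \<Psi>_def)

  have \<Psi>_linf: "\<Psi> \<alpha> \<in> linf" if "\<alpha> \<in> A" for \<alpha>
    unfolding \<Psi>_def
    by (rule timed_frechet_linf[of _ _ _ "max D \<tau>max"]) (use \<rho>_bd[OF aA that] t_bd[OF that] in \<open>auto simp: le_max_iff_disj\<close>)
  have iso: "linf_dist (\<Psi> \<alpha>) (\<Psi> \<beta>) = \<rho> \<alpha> \<beta>" if "\<alpha> \<in> A" "\<beta> \<in> A" for \<alpha> \<beta>
    unfolding \<Psi>_def
    by (rule timed_frechet_isometry[of A]) (use \<rho>_tri \<rho>_sym t_lip aA a_dense \<Psi>_linf that in \<open>auto simp: \<Psi>_def\<close>)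
  \<comment> \<open>For \<open>s = \<Psi> \<alpha>\<close>, the distance from
    \<open>\<Psi> (a i)\<close> to \<open>s\<close> is \<open>\<rho> (a i) \<alpha>\<close> by the
    isometry, and this is already coordinate \<open>Suc i\<close> of \<open>s\<close>.\<close>
  have id_frechet: "timed_frechet linf_dist \<tau>inf (\<lambda>i. \<Psi> (a i)) s = s" if s: "s \<in> Xinf" for s
  proof
    obtain \<alpha> where "\<alpha> \<in> A" "s = \<Psi> \<alpha>" using s by (auto simp: Xinf_def)
    then show "timed_frechet linf_dist \<tau>inf (\<lambda>i. \<Psi> (a i)) s i = s i" for i
      by (cases i) (simp_all add: \<tau>inf_def \<Psi>_simps iso aA)
  qed
  have dense_inf: "dense_seq Xinf linf_dist (\<lambda>i. \<Psi> (a i))"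
    unfolding dense_seq_def
  proof (intro conjI ballI allI impI)
    show "range (\<lambda>i. \<Psi> (a i)) \<subseteq> Xinf" using aA by (auto simp: Xinf_def)
    fix s and e :: real assume "s \<in> Xinf" "0 < e"
    then obtain \<alpha> where \<alpha>: "\<alpha> \<in> A" "s = \<Psi> \<alpha>" by (auto simp: Xinf_def)
    obtain i where "\<rho> \<alpha> (a i) \<le> e / 2" using a_dense[OF \<alpha>(1), of "e/2"] \<open>0 < e\<close> by auto
    then have "linf_dist (\<Psi> (a i)) s < e"
      using \<alpha> \<open>0 < e\<close> iso[OF aA \<alpha>(1), of i] \<rho>_sym[OF aA \<alpha>(1), of i] by simp
    then show "\<exists>i. linf_dist (\<Psi> (a i)) s < e" ..
  qed
  have dense_N: "dense_seq (X j) (d j) (N j)" for j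
    unfolding dense_seq_def
  proof (intro conjI ballI allI impI)
    show "range (N j) \<subseteq> X j" using aA IX by (auto simp: N_def)
    fix x and e :: real assume "x \<in> X j" "0 < e"
    then obtain \<alpha> where \<alpha>: "\<alpha> \<in> A" "x = I j \<alpha>" using IA[of j] by blast
    obtain i where "\<rho>' j \<alpha> (a i) \<le> e / 2" using a[of "e/2"] \<alpha>(1) \<open>0 < e\<close> by (metis half_gt_zero)
    then have "d j (N j i) x < e"
      using \<rho>'_sym[OF \<alpha>(1) aA, of j i] \<open>0 < e\<close> by (simp add: N_def \<rho>'_def \<alpha>)
    then show "\<exists>i. d j (N j i) x < e" ..
  qed

  \<comment> \<open>Compactness of the limit space\<close>
  have cpt_inf: "compact_in Xinf linf_dist Xinf"
    unfolding compact_in_def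
  proof (intro conjI allI impI subset_refl)
    fix \<sigma> :: "nat \<Rightarrow> nat \<Rightarrow> real" assume "range \<sigma> \<subseteq> Xinf"
    then have "\<forall>n. \<exists>\<alpha>\<in>A. \<sigma> n = \<Psi> \<alpha>" unfolding Xinf_def by blast
    then obtain b where b: "\<And>n. b n \<in> A" "\<And>n. \<sigma> n = \<Psi> (b n)" by metis
    \<comment> \<open>The limit is sought among addresses: longer and longer prefixes agree with
      \<open>\<alpha>\<close>, and the modulus turns agreement of prefixes into small
      distances.\<close>
    obtain s \<alpha> where s: "strict_mono (s :: nat \<Rightarrow> nat)" "\<alpha> \<in> A"
      and ev: "\<And>k. \<forall>\<^sub>F n in sequentially. \<forall>i<k. b (s n) i = \<alpha> i"
      using addresses_subsequence[of b M] b(1) unfolding A_def by blast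
    have "(\<lambda>n. linf_dist (\<sigma> (s n)) (\<Psi> \<alpha>)) \<longlonglongrightarrow> 0"
    proof (rule tendstoI)
      fix e :: real assume "0 < e"
      then obtain k where k: "\<And>\<alpha> \<beta>. (\<forall>i<k. \<alpha> i = \<beta> i) \<longrightarrow> (\<forall>j. \<rho>' j \<alpha> \<beta> \<le> e / 2)"
        using modulus[of "e / 2"] by auto
      show "\<forall>\<^sub>F n in sequentially. dist (linf_dist (\<sigma> (s n)) (\<Psi> \<alpha>)) 0 < e"
        using ev[of k]
      proof eventually_elim
        case (elim n)
        then have "\<rho> (b (s n)) \<alpha> \<le> e / 2"
          using k by (intro \<rho>_le b s) blast
        then show ?case
          using \<open>0 < e\<close> \<rho>_bd[OF b(1) s(2), of "s n"] by (simp add: b(2) iso[OF b(1) s(2)])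
      qed
    qed
    then show "\<exists>l\<in>Xinf. \<exists>r. strict_mono r \<and> (\<lambda>n. linf_dist (\<sigma> (r n)) l) \<longlonglongrightarrow> 0"
      using s unfolding Xinf_def by blast
  qed
  have ctms: "compact_timed_metric_space Xinf linf_dist \<tau>inf"
  proof -
    have "Xinf \<subseteq> linf" using \<Psi>_linf by (auto simp: Xinf_def)
    then have "metric_on Xinf linf_dist"
      using metric_on_linf unfolding metric_on_def by (meson subsetD)
    moreover have "0 \<le> \<tau>inf s" if "s \<in> Xinf" for s
      using that t_bd by (auto simp: Xinf_def \<tau>inf_def \<Psi>_simps)
    moreover have "\<bar>\<tau>inf s - \<tau>inf u\<bar> \<le> linf_dist s u" if "s \<in> Xinf" "u \<in> Xinf" for s u
      using that t_lip by (auto simp: Xinf_def \<tau>inf_def \<Psi>_simps iso)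
    ultimately show ?thesis
      using cpt_inf by (simp add: compact_timed_metric_space_def)
  qed

  \<comment> \<open>A compact set containing all the images\<close>
  have Z: "Z \<subseteq> linf \<and> compact_in linf linf_dist Z"
  proof (rule compact_equicontinuous[of "\<lambda>i i' e. \<forall>j. \<rho>' j (a i) (a i') \<le> e"])
    show "\<exists>m. \<forall>i. \<exists>i'<m. \<forall>j. \<rho>' j (a i) (a i') \<le> e" if "0 < e" for e
      using a[OF that] aA by blast
  qed (fact Z_def)
  have \<phi>_Z: "\<phi> j ` X (r j) \<subseteq> time_prod \<tau>max Z" for j
  proof -
    have "\<phi> j (I (r j) \<alpha>) \<in> time_prod \<tau>max Z" if "\<alpha> \<in> A" for \<alpha>
    proof -
      \<comment> \<open>Reverse triangle inequality: two distance coordinates of one point differ by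
        at most the distance between their base points.\<close>
      have "\<bar>\<rho>' (r j) (a i) \<alpha> - \<rho>' (r j) (a i') \<alpha>\<bar> \<le> e" if "\<forall>j. \<rho>' j (a i) (a i') \<le> e" for i i' e
        using \<rho>'_tri[of "a i" "a i'" \<alpha> "r j"] \<rho>'_tri[of "a i'" "a i" \<alpha> "r j"]
          \<rho>'_sym[of "a i" "a i'" "r j"] aA \<open>\<alpha> \<in> A\<close> that[rule_format, of "r j"] by (simp add: abs_le_iff)
      then show ?thesis
        using \<theta>'_bd[OF \<open>\<alpha> \<in> A\<close>] \<rho>'_bd[OF aA \<open>\<alpha> \<in> A\<close>] unfolding time_prod_def Z_def by (simp add: \<phi>_I)
    qed
    then show ?thesis
      unfolding IA[of "r j", symmetric] by (auto simp del: image_subset_iff)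
  qed
  have \<Psi>_Z: "\<Psi> ` A \<subseteq> time_prod \<tau>max Z"
  proof (rule image_subsetI)
    fix \<alpha> assume "\<alpha> \<in> A"
    have "\<bar>\<rho> (a i) \<alpha> - \<rho> (a i') \<alpha>\<bar> \<le> e" if "\<forall>j. \<rho>' j (a i) (a i') \<le> e" for i i' e
      using \<rho>_tri[of "a i" "a i'" \<alpha>] \<rho>_tri[of "a i'" "a i" \<alpha>]
        \<rho>_sym[of "a i" "a i'"] \<rho>_le[of "a i" "a i'" e] aA \<open>\<alpha> \<in> A\<close> that by (simp add: abs_le_iff)
    then show "\<Psi> \<alpha> \<in> time_prod \<tau>max Z"
      using t_bd[OF \<open>\<alpha> \<in> A\<close>] \<rho>_bd[OF aA \<open>\<alpha> \<in> A\<close>] unfolding time_prod_def Z_def by (simp add: \<Psi>_simps(1,2))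
  qed

  \<comment> \<open>Convergence of the Frechet images, distances and times\<close>
  have conv: "\<forall>\<^sub>F j in sequentially. \<forall>\<alpha>\<in>A. linf_dist (\<phi> j (I (r j) \<alpha>)) (\<Psi> \<alpha>) \<le> e" if "0 < e" for e
    using conv_t[OF that] conv_\<rho>[OF that]
  proof eventually_elim
    case (elim j)
    show ?case
    proof (intro ballI linf_dist_le)
      fix \<alpha> i assume "\<alpha> \<in> A"
      then show "\<bar>\<phi> j (I (r j) \<alpha>) i - \<Psi> \<alpha> i\<bar> \<le> e"
        using elim aA by (cases i) (auto simp: \<phi>_I \<Psi>_simps)
    qed
  qed

  let ?H = "\<lambda>j. hausdorff_linf (\<phi> j ` X (r j)) (\<Psi> ` A)"
  \<comment> \<open>Since the Frechet map of the limit is the identity, \<open>?H j\<close> is one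
    of the competitors in the infimum that defines the intrinsic distance.\<close>
  have frechet_image: "timed_frechet linf_dist \<tau>inf (\<lambda>i. \<Psi> (a i)) ` Xinf = \<Psi> ` A"
    using id_frechet by (simp add: Xinf_def)
  have bounds: "0 \<le> ?H j"
    "0 \<le> intrinsic_timed_hausdorff (X (r j)) (d (r j)) (\<tau> (r j)) Xinf linf_dist \<tau>inf"
    "intrinsic_timed_hausdorff (X (r j)) (d (r j)) (\<tau> (r j)) Xinf linf_dist \<tau>inf \<le> ?H j" for j
  proof -
    have 1: "Xinf \<noteq> {}" using \<open>A \<noteq> {}\<close> by (simp add: Xinf_def)
    have 2: "\<forall>x\<in>X (r j). \<forall>y\<in>X (r j). d (r j) x y \<in> {0..max D \<tau>max}"
      using nonneg equibounded by (simp add: le_max_iff_disj)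
    have 3: "\<forall>x\<in>X (r j). \<tau> (r j) x \<in> {0..max D \<tau>max}"
      using time_bound by (simp add: le_max_iff_disj)
    have 4: "\<forall>s\<in>Xinf. \<forall>u\<in>Xinf. linf_dist s u \<in> {0..max D \<tau>max}"
      using \<rho>_bd by (auto simp: Xinf_def iso le_max_iff_disj)
    have 5: "\<forall>s\<in>Xinf. \<tau>inf s \<in> {0..max D \<tau>max}"
      using t_bd by (auto simp: Xinf_def \<tau>inf_def \<Psi>_simps le_max_iff_disj)
    note b = intrinsic_timed_hausdorff_bounds[OF nonempty[of "r j"] 1 2 3 4 5 dense_N dense_inf,
      unfolded frechet_image, folded \<phi>_def]
    show "0 \<le> ?H j"
      "0 \<le> intrinsic_timed_hausdorff (X (r j)) (d (r j)) (\<tau> (r j)) Xinf linf_dist \<tau>inf"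
      "intrinsic_timed_hausdorff (X (r j)) (d (r j)) (\<tau> (r j)) Xinf linf_dist \<tau>inf \<le> ?H j"
      using b by blast+
  qed
  have H_lim: "?H \<longlonglongrightarrow> 0"
  proof (rule tendstoI)
    fix e :: real assume "0 < e"
    \<comment> \<open>Two losses of strictness are absorbed: \<open>\<le> e / 3\<close> gives the
      strict \<open>< e / 2\<close> required of an admissible radius, and the resulting bound
      \<open>\<le> e / 2\<close> is strictly below \<open>e\<close>.\<close>
    then have "\<forall>\<^sub>F j in sequentially. \<forall>\<alpha>\<in>A. linf_dist (\<phi> j (I (r j) \<alpha>)) (\<Psi> \<alpha>) \<le> e / 3"
      by (intro conv) simp
    then show "\<forall>\<^sub>F j in sequentially. dist (?H j) 0 < e"
    proof eventually_elim
      case (elim j)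
      then have close: "linf_dist (\<phi> j (I (r j) \<alpha>)) (\<Psi> \<alpha>) < e / 2" if "\<alpha> \<in> A" for \<alpha>
        using that \<open>0 < e\<close> by fastforce
      have "?H j \<le> e / 2"
      proof (rule hausdorff_linf_le)
        \<comment> \<open>In both directions the partner of a point is the point with the same
          address.\<close>
        show "\<exists>w\<in>\<Psi> ` A. linf_dist u w < e / 2" if "u \<in> \<phi> j ` X (r j)" for u
          using that close unfolding IA[of "r j", symmetric] by blast
        show "\<exists>u\<in>\<phi> j ` X (r j). linf_dist u w < e / 2" if "w \<in> \<Psi> ` A" for w
          using that close unfolding IA[of "r j", symmetric] by blast
      qed (use \<open>0 < e\<close> in simp)
      then show ?case using bounds(1)[of j] \<open>0 < e\<close> by simp
    qed
  qed
  have intrinsic_lim: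
    "(\<lambda>j. intrinsic_timed_hausdorff (X (r j)) (d (r j)) (\<tau> (r j)) Xinf linf_dist \<tau>inf) \<longlonglongrightarrow> 0"
    by (rule tendsto_sandwich[OF _ _ tendsto_const H_lim]) (simp_all add: bounds)
  have sup1: "(\<lambda>j. SUP \<alpha>\<in>A. linf_dist (\<phi> j (I (r j) \<alpha>)) (\<Psi> \<alpha>)) \<longlonglongrightarrow> 0"
  proof (rule SUP_tendsto_0[OF \<open>A \<noteq> {}\<close> _ conv])
    fix j \<alpha> assume \<alpha>: "\<alpha> \<in> A"
    have "\<phi> j (I (r j) \<alpha>) \<in> linf"
      unfolding \<phi>_def using \<rho>'_bd[OF aA \<alpha>, of "r j"] \<theta>'_bd[OF \<alpha>, of "r j"]
      by (intro timed_frechet_linf[of _ _ _ "max D \<tau>max"]) (auto simp: N_def \<rho>'_def \<theta>'_def le_max_iff_disj)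
    then show "0 \<le> linf_dist (\<phi> j (I (r j) \<alpha>)) (\<Psi> \<alpha>)"
      using metric_on_linf \<Psi>_linf[OF \<alpha>] unfolding metric_on_def by blast
  qed
  have sup2: "(\<lambda>j. SUP \<alpha>\<in>A. \<bar>\<tau> (r j) (I (r j) \<alpha>) - \<tau>inf (\<Psi> \<alpha>)\<bar>) \<longlonglongrightarrow> 0"
    by (rule SUP_tendsto_0[OF \<open>A \<noteq> {}\<close>]) (use conv_t in \<open>auto simp: \<theta>'_def \<tau>inf_def \<Psi>_simps\<close>)
  have sup3: "(\<lambda>j. SUP p\<in>A \<times> A. \<bar>d (r j) (I (r j) (fst p)) (I (r j) (snd p))
      - linf_dist (\<Psi> (fst p)) (\<Psi> (snd p))\<bar>) \<longlonglongrightarrow> 0"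
  proof (rule SUP_tendsto_0)
    show "\<forall>\<^sub>F j in sequentially. \<forall>p\<in>A \<times> A. \<bar>d (r j) (I (r j) (fst p)) (I (r j) (snd p))
      - linf_dist (\<Psi> (fst p)) (\<Psi> (snd p))\<bar> \<le> e" if "0 < e" for e
      using conv_\<rho>[OF that] by (rule eventually_mono) (auto simp: \<rho>'_def iso)
  qed (use \<open>A \<noteq> {}\<close> in auto)
  have maps: "is_timed_frechet_map (X (r j)) (d (r j)) (\<tau> (r j)) (\<phi> j)" for j
    unfolding is_timed_frechet_map_def \<phi>_def by (rule exI[of _ "N (r j)"]) (simp add: dense_N)
  have map_inf: "is_timed_frechet_map Xinf linf_dist \<tau>inf (\<lambda>s. s)"
    unfolding is_timed_frechet_map_def
    by (rule exI[of _ "\<lambda>i. \<Psi> (a i)"]) (simp add: dense_inf id_frechet)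
  \<comment> \<open>The limit Frechet map is the identity because \<open>Xinf\<close> already lies
    in the sequence space, and \<open>\<Psi>\<close> itself is its address map.\<close>
  show ?thesis
    by (rule exI[of _ r], rule exI[of _ Xinf], rule exI[of _ linf_dist], rule exI[of _ \<tau>inf],
        rule exI[of _ Z], rule exI[of _ \<phi>], rule exI[of _ "\<lambda>s. s"], rule exI[of _ A],
        rule exI[of _ "\<lambda>j. I (r j)"], rule exI[of _ \<Psi>])
      (use r ctms intrinsic_lim Z maps \<phi>_Z map_inf \<Psi>_Z H_lim uncountable IA sup1 sup2 sup3
        in \<open>simp add: Xinf_def\<close>)
qed

end
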